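(* For the graph $L_{q,1,k}$, we have $$ABC(L_{q,1,k})=\frac{4k-6}{3}+\frac{qk-k+2}{\sqrt{2}}.$$
   Context: For a finite simple graph $G$, the atom-bond connectivity index is $ABC(G)=\sum_{uv\in E(G)}\sqrt{\frac{d_u+d_v-2}{d_ud_v}}$, where $d_u$ is the degree of the vertex $u$ in $G$. $C_q$ denotes the cycle with $q$ vertices. The link of pairwise disjoint connected graphs $G_1,\ldots,G_k$ with respect to vertices $x_i,y_i\in V(G_i)$ is the graph obtained from their disjoint union by adding the edge $y_ix_{i+1}$ for each $i=1,\ldots,k-1$. The graph $L_{q,h,k}$ is the link of $k$ cycles $C_q$ in which the distance between the two contact vertices $x_i,y_i$ in the same cycle is $h$; $L_{q,1,k}$ is the case $h=1$.
   Formalization: The formal theorem assumes k ≥ 2 (and q ≥ 3, so that C_q is a cycle); for k = 1 the graph is C_q with ABC = q/√2, and the stated formula fails. *)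

theory Defs
  imports Complex_Main
begin

record 'a sgraph =
  vertices :: "'a set"
  edges :: "'a set set"

definition finite_simple_graph :: "'a sgraph \<Rightarrow> bool" where
  "finite_simple_graph G \<longleftrightarrow>
     finite (vertices G) \<and> (\<forall>e\<in>edges G. e \<subseteq> vertices G \<and> card e = 2)"

definition degree :: "'a sgraph \<Rightarrow> 'a \<Rightarrow> nat" where
  "degree G v = card {u \<in> vertices G. {u, v} \<in> edges G}"

text \<open>An edge is a two-element set \<open>{u, v}\<close>, so the sum and the product over the edge
  are \<open>d\<^sub>u + d\<^sub>v\<close> and \<open>d\<^sub>u d\<^sub>v\<close>; see \<open>abc_weight_doubleton\<close>.\<close>

definition abc_weight :: "'a sgraph \<Rightarrow> 'a set \<Rightarrow> real" where
  "abc_weight G e =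
     sqrt (((\<Sum>v\<in>e. real (degree G v)) - 2) / (\<Prod>v\<in>e. real (degree G v)))"

lemma abc_weight_doubleton:
  assumes "u \<noteq> v"
  shows "abc_weight G {u, v} =
    sqrt ((real (degree G u) + real (degree G v) - 2) / (real (degree G u) * real (degree G v)))"
  using assms by (simp add: abc_weight_def)

definition ABC :: "'a sgraph \<Rightarrow> real" where
  "ABC G = (\<Sum>e\<in>edges G. abc_weight G e)"

definition walk :: "'a sgraph \<Rightarrow> 'a \<Rightarrow> 'a list \<Rightarrow> 'a \<Rightarrow> bool" where
  "walk G u p v \<longleftrightarrow>
     p \<noteq> [] \<and> hd p = u \<and> last p = v \<and> set p \<subseteq> vertices G \<and>
     (\<forall>i. Suc i < length p \<longrightarrow> {p ! i, p ! Suc i} \<in> edges G)"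

definition connected_graph :: "'a sgraph \<Rightarrow> bool" where
  "connected_graph G \<longleftrightarrow>
     vertices G \<noteq> {} \<and> (\<forall>u\<in>vertices G. \<forall>v\<in>vertices G. \<exists>p. walk G u p v)"

text \<open>A walk with \<open>n\<close> edges is a list of \<open>n + 1\<close> vertices. The value is meaningful only if
  \<open>u\<close> and \<open>v\<close> are joined by a walk.\<close>

definition graph_distance :: "'a sgraph \<Rightarrow> 'a \<Rightarrow> 'a \<Rightarrow> nat" where
  "graph_distance G u v = (LEAST n. \<exists>p. walk G u p v \<and> length p = Suc n)"

definition isomorphic :: "'a sgraph \<Rightarrow> 'b sgraph \<Rightarrow> bool" where
  "isomorphic G H \<longleftrightarrow>
     (\<exists>f. bij_betw f (vertices G) (vertices H) \<and>
        (\<forall>u\<in>vertices G. \<forall>v\<in>vertices G. {u, v} \<in> edges G \<longleftrightarrow> {f u, f v} \<in> edges H))"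

text \<open>This is the cycle \<open>C\<^sub>q\<close> only for \<open>q \<ge> 3\<close>.\<close>

definition cycle_graph :: "nat \<Rightarrow> nat sgraph" where
  "cycle_graph q =
     \<lparr>vertices = {..<q}, edges = {{i, Suc i mod q} | i. i < q}\<rparr>"

text \<open>Families are indexed by \<open>1, \<dots>, k\<close>; values at other indices are irrelevant.\<close>

definition linkable ::
  "nat \<Rightarrow> (nat \<Rightarrow> 'a sgraph) \<Rightarrow> (nat \<Rightarrow> 'a) \<Rightarrow> (nat \<Rightarrow> 'a) \<Rightarrow> bool" where
  "linkable k G x y \<longleftrightarrow>
     (\<forall>i\<in>{1..k}. finite_simple_graph (G i) \<and> connected_graph (G i) \<and>
        x i \<in> vertices (G i) \<and> y i \<in> vertices (G i)) \<and>
     (\<forall>i\<in>{1..k}. \<forall>j\<in>{1..k}. i \<noteq> j \<longrightarrow> vertices (G i) \<inter> vertices (G j) = {})"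

definition link ::
  "nat \<Rightarrow> (nat \<Rightarrow> 'a sgraph) \<Rightarrow> (nat \<Rightarrow> 'a) \<Rightarrow> (nat \<Rightarrow> 'a) \<Rightarrow> 'a sgraph" where
  "link k G x y =
     \<lparr>vertices = (\<Union>i\<in>{1..k}. vertices (G i)),
      edges = (\<Union>i\<in>{1..k}. edges (G i)) \<union> {{y i, x (Suc i)} | i. 1 \<le> i \<and> i < k}\<rparr>"

text \<open>\<open>is_L q h k H\<close> states that \<open>H\<close> is (a labelled copy of) the graph \<open>L\<^bsub>q,h,k\<^esub>\<close>.\<close>

definition is_L :: "nat \<Rightarrow> nat \<Rightarrow> nat \<Rightarrow> 'a sgraph \<Rightarrow> bool" where
  "is_L q h k H \<longleftrightarrow>
     (\<exists>G x y. linkable k G x y \<and>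
        (\<forall>i\<in>{1..k}. isomorphic (G i) (cycle_graph q) \<and> graph_distance (G i) (x i) (y i) = h) \<and>
        H = link k G x y)"

end

theory Submission
  imports Defs
begin

text \<open>
  An edge with an end of degree 2 has weight \<open>sqrt (d / (2 * d)) = 1 / sqrt 2\<close>, whatever the degree
  \<open>d \<ge> 1\<close> of its other end, and an edge whose ends both have degree 3 has weight \<open>sqrt (4 / 9) = 2 / 3\<close>.
  So for a graph whose edges only join vertices of degree 2 or 3, the index depends only on the number
  of edges and the number of edges of the second kind (\<open>ABC_degrees_2_3\<close>).

  In a link of cycles every vertex has degree 2 in its own cycle, and each linking edge raises the
  degrees of its two ends by one (\<open>degree_link\<close>). If the contact vertices of each cycle are distinct,
  no vertex is raised twice; hence all degrees are 2 or 3, and the vertices of degree 3 are exactly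
  the ends of linking edges. For \<open>h = 1\<close> the contact vertices of one cycle are adjacent, so the edges
  between vertices of degree 3 are the \<open>k - 1\<close> linking edges and one edge in each of the \<open>k - 2\<close>
  inner cycles, \<open>2 * k - 3\<close> in total. All \<open>q * k + (k - 1)\<close> edges together therefore contribute
  \<open>2 / 3 * (2 * k - 3) + (q * k - k + 2) / sqrt 2\<close>.
\<close>

section \<open>Graphs with degrees 2 and 3\<close>

lemma finite_edges:
  assumes "finite_simple_graph G"
  shows "finite (edges G)"
proof (rule finite_subset)
  show "edges G \<subseteq> Pow (vertices G)" "finite (Pow (vertices G))"
    using assms by (auto simp: finite_simple_graph_def)
qed

lemma edge_endpoints:
  assumes "finite_simple_graph G" "e \<in> edges G"
  obtains u v where "e = {u, v}" "u \<noteq> v" "u \<in> vertices G" "v \<in> vertices G"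
proof -
  have "e \<subseteq> vertices G" "card e = 2"
    using assms by (auto simp: finite_simple_graph_def)
  then show ?thesis
    using that by (auto simp: card_2_iff)
qed

lemma edge_in_vertices:
  assumes "finite_simple_graph G" "{u, v} \<in> edges G"
  shows "u \<in> vertices G" "v \<in> vertices G" "u \<noteq> v"
  using assms by (auto simp: finite_simple_graph_def)

lemma abc_weight_degrees_2_3:
  assumes "u \<noteq> v" "degree G u \<in> {2, 3}" "degree G v \<in> {2, 3}"
  shows "abc_weight G {u, v} =
    (if degree G u = 3 \<and> degree G v = 3 then 2 / 3 else 1 / sqrt 2)"
proof -
  have "sqrt (4 / 9) = (2 / 3 :: real)"
    by (rule real_sqrt_unique) (auto simp: power2_eq_square)
  moreover have "(2 / 4 :: real) = 1 / 2" "(3 / 6 :: real) = 1 / 2"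
    by auto
  moreover have "sqrt (1 / 2) = 1 / sqrt 2"
    by (simp add: real_sqrt_divide)
  ultimately show ?thesis
    using assms by (auto simp: abc_weight_doubleton simp del: real_sqrt_divide)
qed

lemma ABC_degrees_2_3:
  assumes G: "finite_simple_graph G"
    and deg: "\<And>v. v \<in> vertices G \<Longrightarrow> degree G v \<in> {2, 3}"
    and M: "M = {e \<in> edges G. \<forall>v\<in>e. degree G v = 3}"
  shows "ABC G = 2 / 3 * real (card M) + (real (card (edges G)) - real (card M)) / sqrt 2"
proof -
  have fin: "finite (edges G)" and sub: "M \<subseteq> edges G"
    using finite_edges[OF G] M by auto
  have weight: "abc_weight G e = (if e \<in> M then 2 / 3 else 1 / sqrt 2)" if e: "e \<in> edges G" for e
  proof -
    obtain u v where uv: "e = {u, v}" "u \<noteq> v" "u \<in> vertices G" "v \<in> vertices G"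
      using edge_endpoints[OF G e] .
    have "e \<in> M \<longleftrightarrow> degree G u = 3 \<and> degree G v = 3"
      using e uv(1) M by auto
    then show ?thesis
      using abc_weight_degrees_2_3[OF uv(2) deg[OF uv(3)] deg[OF uv(4)]] uv(1) by simp
  qed
  have "ABC G = (\<Sum>e\<in>M. abc_weight G e) + (\<Sum>e\<in>edges G - M. abc_weight G e)"
    unfolding ABC_def using sum.subset_diff[OF sub fin, of "abc_weight G"] by simp
  also have "(\<Sum>e\<in>M. abc_weight G e) = 2 / 3 * real (card M)"
    using weight sub by (simp add: subset_iff)
  also have "(\<Sum>e\<in>edges G - M. abc_weight G e) = real (card (edges G - M)) / sqrt 2"
    using weight by simp
  also have "real (card (edges G - M)) = real (card (edges G)) - real (card M)"
    using fin sub by (simp add: card_Diff_subset finite_subset card_mono of_nat_diff)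
  finally show ?thesis .
qed

section \<open>Cycles and their isomorphic copies\<close>

lemma cycle_edge_iff:
  "{u, v} \<in> edges (cycle_graph q) \<longleftrightarrow>
    (u < q \<and> v = Suc u mod q) \<or> (v < q \<and> u = Suc v mod q)"
  by (auto simp: cycle_graph_def doubleton_eq_iff)

lemma Suc_mod_less: "i < q \<Longrightarrow> Suc i mod q = (if Suc i = q then 0 else Suc i)"
  by auto

lemma finite_simple_cycle_graph:
  assumes "q \<ge> 3"
  shows "finite_simple_graph (cycle_graph q)"
proof -
  have "i \<noteq> Suc i mod q" if "i < q" for i
    using that assms by (auto simp: Suc_mod_less)
  then show ?thesis
    by (auto simp: finite_simple_graph_def cycle_graph_def)
qed

text \<open>Here \<open>q \<ge> 3\<close> matters: for \<open>q = 2\<close> the two formal edges coincide.\<close>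

lemma card_edges_cycle_graph:
  assumes "q \<ge> 3"
  shows "card (edges (cycle_graph q)) = q"
proof -
  have "edges (cycle_graph q) = (\<lambda>i. {i, Suc i mod q}) ` {..<q}"
    by (auto simp: cycle_graph_def)
  moreover have "inj_on (\<lambda>i. {i, Suc i mod q}) {..<q}"
    using assms by (auto simp: inj_on_def doubleton_eq_iff Suc_mod_less split: if_splits)
  ultimately show ?thesis
    by (simp add: card_image)
qed

lemma degree_cycle_graph:
  assumes "q \<ge> 3" "v < q"
  shows "degree (cycle_graph q) v = 2"
proof -
  have "{u \<in> vertices (cycle_graph q). {u, v} \<in> edges (cycle_graph q)} =
      {if Suc v = q then 0 else Suc v, if v = 0 then q - 1 else v - 1}"
    unfolding cycle_edge_iff using assms
    by (cases "v = 0") (auto simp: cycle_graph_def Suc_mod_less cong: conj_cong split: if_splits)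
  moreover have "(if Suc v = q then 0 else Suc v) \<noteq> (if v = 0 then q - 1 else v - 1)"
    using assms by auto
  ultimately show ?thesis
    by (simp add: degree_def)
qed

lemma isomorphic_card_edges_and_degree:
  assumes G: "finite_simple_graph G" and H: "finite_simple_graph H"
    and iso: "isomorphic G H"
  shows "card (edges G) = card (edges H)"
    and "\<And>v. v \<in> vertices G \<Longrightarrow> \<exists>w\<in>vertices H. degree G v = degree H w"
proof -
  obtain f where f: "bij_betw f (vertices G) (vertices H)"
    and adj: "\<And>u v. u \<in> vertices G \<Longrightarrow> v \<in> vertices G \<Longrightarrow>
      {u, v} \<in> edges G \<longleftrightarrow> {f u, f v} \<in> edges H"
    using iso by (auto simp: isomorphic_def)
  have inj: "inj_on f (vertices G)" and im: "f ` vertices G = vertices H"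
    using f by (auto simp: bij_betw_def)
  have "inj_on (image f) (edges G)"
    by (rule inj_on_subset[OF inj_on_image_Pow[OF inj]])
      (use G in \<open>auto simp: finite_simple_graph_def\<close>)
  moreover have "image f ` edges G = edges H"
  proof (intro equalityI subsetI)
    fix e assume "e \<in> image f ` edges G"
    then obtain d where d: "d \<in> edges G" "e = f ` d" by auto
    obtain u v where "d = {u, v}" "u \<in> vertices G" "v \<in> vertices G"
      using edge_endpoints[OF G d(1)] by metis
    then show "e \<in> edges H" using d adj by auto
  next
    fix e assume e: "e \<in> edges H"
    obtain u v where "e = {u, v}" "u \<in> vertices H" "v \<in> vertices H"
      using edge_endpoints[OF H e] by metis
    moreover from this obtain a b where "u = f a" "a \<in> vertices G" "v = f b" "b \<in> vertices G"
      using im by blast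
    ultimately have ab: "e = f ` {a, b}" "a \<in> vertices G" "b \<in> vertices G"
      by auto
    then have "{a, b} \<in> edges G" using e adj[of a b] by simp
    then show "e \<in> image f ` edges G" using ab(1) by blast
  qed
  ultimately show "card (edges G) = card (edges H)"
    by (metis card_image)
  fix v assume v: "v \<in> vertices G"
  have nb: "f ` {u \<in> vertices G. {u, v} \<in> edges G} = {u \<in> vertices H. {u, f v} \<in> edges H}"
    using adj[OF _ v] unfolding im[symmetric] by auto
  have "inj_on f {u \<in> vertices G. {u, v} \<in> edges G}"
    by (rule inj_on_subset[OF inj]) auto
  then have "degree G v = degree H (f v)"
    unfolding degree_def nb[symmetric] by (simp add: card_image)
  moreover have "f v \<in> vertices H"
    unfolding im[symmetric] using v by (rule imageI)
  ultimately show "\<exists>w\<in>vertices H. degree G v = degree H w" ..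
qed

lemma cycle_copy:
  assumes "q \<ge> 3" "finite_simple_graph G" "isomorphic G (cycle_graph q)"
  shows "card (edges G) = q" and "\<And>v. v \<in> vertices G \<Longrightarrow> degree G v = 2"
proof -
  note iso = isomorphic_card_edges_and_degree[OF assms(2) finite_simple_cycle_graph[OF assms(1)]
      assms(3)]
  show "card (edges G) = q"
    using iso(1) card_edges_cycle_graph[OF assms(1)] by simp
  show "degree G v = 2" if "v \<in> vertices G" for v
    using iso(2)[OF that] degree_cycle_graph[OF assms(1)] by (auto simp: cycle_graph_def)
qed

text \<open>Connectedness is what makes the minimum in \<open>graph_distance\<close> range over a nonempty set, so that
  it is attained by an actual walk.\<close>

lemma graph_distance_1_imp_edge:
  assumes "connected_graph G" "u \<in> vertices G" "v \<in> vertices G" "graph_distance G u v = 1"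
  shows "{u, v} \<in> edges G"
proof -
  obtain p where p: "walk G u p v"
    using assms(1-3) unfolding connected_graph_def by blast
  then have "length p = Suc (length p - 1)"
    by (simp add: walk_def)
  with p have "\<exists>n p. walk G u p v \<and> length p = Suc n"
    by blast
  then have "\<exists>p. walk G u p v \<and> length p = Suc (graph_distance G u v)"
    unfolding graph_distance_def by (rule LeastI_ex)
  then obtain r where r: "walk G u r v" "length r = Suc (Suc 0)"
    using assms(4) by auto
  then obtain a b where "r = [a, b]"
    by (auto simp: length_Suc_conv)
  then show ?thesis
    using r by (auto simp: walk_def)
qed

section \<open>Edges and degrees of a link\<close>

locale linked_graphs =
  fixes k :: nat and G :: "nat \<Rightarrow> 'a sgraph" and x y :: "nat \<Rightarrow> 'a"
  assumes linkable: "linkable k G x y"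
begin

lemma part:
  assumes "i \<in> {1..k}"
  shows "finite_simple_graph (G i)" "connected_graph (G i)"
    "x i \<in> vertices (G i)" "y i \<in> vertices (G i)"
  using linkable assms by (auto simp: linkable_def)

lemma part_unique:
  assumes "i \<in> {1..k}" "j \<in> {1..k}" "v \<in> vertices (G i)" "v \<in> vertices (G j)"
  shows "i = j"
  using linkable assms unfolding linkable_def by blast

lemma vertices_link: "vertices (link k G x y) = (\<Union>i\<in>{1..k}. vertices (G i))"
  by (simp add: link_def)

definition linking_edge :: "nat \<Rightarrow> 'a set" where
  "linking_edge i = {y i, x (Suc i)}"

lemma edges_link:
  "edges (link k G x y) = (\<Union>i\<in>{1..k}. edges (G i)) \<union> linking_edge ` {1..<k}"
  by (auto simp: link_def linking_edge_def)

lemma linking_edge_not_inner: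
  assumes "i \<in> {1..<k}" "j \<in> {1..k}"
  shows "linking_edge i \<notin> edges (G j)"
proof
  assume "linking_edge i \<in> edges (G j)"
  then have "y i \<in> vertices (G j)" "x (Suc i) \<in> vertices (G j)"
    using edge_in_vertices[OF part(1)[OF assms(2)]] by (auto simp: linking_edge_def)
  then have "i = j" "Suc i = j"
    using part_unique assms part(3)[of "Suc i"] part(4)[of i] by auto
  then show False by simp
qed

lemma inj_on_linking_edge: "inj_on linking_edge {1..<k}"
proof (rule inj_onI)
  fix i j assume i: "i \<in> {1..<k}" and j: "j \<in> {1..<k}" and eq: "linking_edge i = linking_edge j"
  (* Crossed identification of the ends would give both i = j + 1 and j = i + 1. *)
  have "y i = y j \<or> y i = x (Suc j) \<and> y j = x (Suc i)"
    using eq by (auto simp: linking_edge_def doubleton_eq_iff)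
  then show "i = j"
  proof
    assume "y i = y j"
    then show ?thesis
      using part_unique[of i j "y i"] part(4)[of i] part(4)[of j] i j by auto
  next
    assume "y i = x (Suc j) \<and> y j = x (Suc i)"
    moreover have "y i \<in> vertices (G i)" "x (Suc j) \<in> vertices (G (Suc j))"
      "y j \<in> vertices (G j)" "x (Suc i) \<in> vertices (G (Suc i))"
      using part(3)[of "Suc i"] part(3)[of "Suc j"] part(4)[of i] part(4)[of j] i j by simp_all
    moreover have "i \<in> {1..k}" "Suc i \<in> {1..k}" "j \<in> {1..k}" "Suc j \<in> {1..k}"
      using i j by auto
    ultimately have "i = Suc j" "j = Suc i"
      using part_unique by metis+
    then show ?thesis by simp
  qed
qed

lemma finite_simple_link: "finite_simple_graph (link k G x y)"
  unfolding finite_simple_graph_def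
proof (intro conjI ballI)
  show "finite (vertices (link k G x y))"
    using part(1) by (auto simp: vertices_link finite_simple_graph_def)
next
  fix e assume "e \<in> edges (link k G x y)"
  then consider i where "i \<in> {1..k}" "e \<in> edges (G i)" | i where "i \<in> {1..<k}" "e = linking_edge i"
    by (auto simp: edges_link)
  then have "e \<subseteq> vertices (link k G x y) \<and> card e = 2"
  proof cases
    case 1
    then show ?thesis
      using part(1) unfolding vertices_link finite_simple_graph_def by blast
  next
    case 2
    then have "y i \<in> vertices (G i)" "x (Suc i) \<in> vertices (G (Suc i))"
      using part(3,4) by auto
    moreover from this have "y i \<noteq> x (Suc i)"
      using part_unique[of i "Suc i" "y i"] 2 by auto
    moreover have "i \<in> {1..k}" "Suc i \<in> {1..k}"
      using 2 by auto
    ultimately show ?thesis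
      using 2(2) unfolding vertices_link linking_edge_def by auto
  qed
  then show "e \<subseteq> vertices (link k G x y)" "card e = 2" by auto
qed

lemma disjoint_inner_edges:
  assumes "i \<in> {1..k}" "j \<in> {1..k}" "i \<noteq> j"
  shows "edges (G i) \<inter> edges (G j) = {}"
proof (rule ccontr)
  assume "edges (G i) \<inter> edges (G j) \<noteq> {}"
  then obtain e where e: "e \<in> edges (G i)" "e \<in> edges (G j)" by auto
  obtain u v where "e = {u, v}"
    using edge_endpoints[OF part(1)[OF assms(1)] e(1)] by metis
  then have "u \<in> vertices (G i)" "u \<in> vertices (G j)"
    using e edge_in_vertices part(1) assms by metis+
  then show False using part_unique assms by auto
qed

lemma card_edges_link:
  "card (edges (link k G x y)) = (\<Sum>i\<in>{1..k}. card (edges (G i))) + (k - 1)"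
proof -
  have fin: "\<forall>i\<in>{1..k}. finite (edges (G i))"
    using part(1) finite_edges by blast
  have "card (edges (link k G x y)) =
      card (\<Union>i\<in>{1..k}. edges (G i)) + card (linking_edge ` {1..<k})"
    unfolding edges_link using fin linking_edge_not_inner
    by (intro card_Un_disjoint) auto
  also have "card (\<Union>i\<in>{1..k}. edges (G i)) = (\<Sum>i\<in>{1..k}. card (edges (G i)))"
    using fin disjoint_inner_edges by (intro card_UN_disjoint) auto
  also have "card (linking_edge ` {1..<k}) = k - 1"
    using inj_on_linking_edge by (simp add: card_image)
  finally show ?thesis .
qed

text \<open>The neighbours of a vertex of the \<open>i\<close>-th part are its neighbours there, the next contact
  vertex \<open>x (i + 1)\<close> if it is \<open>y i\<close>, and the previous contact vertex \<open>y (i - 1)\<close> if it is \<open>x i\<close>.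
  These lie in three different parts, so the numbers add up, also if \<open>x i = y i\<close>.\<close>

lemma degree_link:
  assumes i: "i \<in> {1..k}" and v: "v \<in> vertices (G i)"
  shows "degree (link k G x y) v =
    degree (G i) v + of_bool (v = y i \<and> i < k) + of_bool (v = x i \<and> 1 < i)"
proof -
  let ?A = "{u \<in> vertices (G i). {u, v} \<in> edges (G i)}"
  let ?B = "if v = y i \<and> i < k then {x (Suc i)} else {}"
  let ?C = "if v = x i \<and> 1 < i then {y (i - 1)} else {}"
  have inner: "j = i" if "j \<in> {1..k}" "{u, v} \<in> edges (G j)" for u j
    using part_unique[OF that(1) i _ v] edge_in_vertices[OF part(1) that(2)] that(1) by auto
  have at_y: "j = i" if "j \<in> {1..<k}" "v = y j" for j
  proof -
    have "j \<in> {1..k}" using that(1) by auto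
    then show ?thesis using part_unique[OF _ i _ v] part(4) that(2) by blast
  qed
  have at_x: "Suc j = i" if "j \<in> {1..<k}" "v = x (Suc j)" for j
  proof -
    have "Suc j \<in> {1..k}" using that(1) by auto
    then show ?thesis using part_unique[OF _ i _ v] part(3) that(2) by blast
  qed
  have "{u \<in> vertices (link k G x y). {u, v} \<in> edges (link k G x y)} = ?A \<union> ?B \<union> ?C"
  proof (intro equalityI subsetI)
    fix u assume "u \<in> {u \<in> vertices (link k G x y). {u, v} \<in> edges (link k G x y)}"
    then consider j where "j \<in> {1..k}" "{u, v} \<in> edges (G j)"
      | j where "j \<in> {1..<k}" "{u, v} = linking_edge j"
      by (auto simp: edges_link)
    then show "u \<in> ?A \<union> ?B \<union> ?C"
    proof cases
      case 1
      then show ?thesis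
        using inner edge_in_vertices[OF part(1)[OF i], of u v] by auto
    next
      case 2
      then have "u = x (Suc j) \<and> v = y j \<or> u = y j \<and> v = x (Suc j)"
        by (auto simp: linking_edge_def doubleton_eq_iff)
      then show ?thesis
      proof
        assume "u = x (Suc j) \<and> v = y j"
        moreover from this have "j = i" using at_y[OF 2(1)] by blast
        ultimately show ?thesis using 2(1) by simp
      next
        assume "u = y j \<and> v = x (Suc j)"
        moreover from this have "i = Suc j" using at_x[OF 2(1)] by blast
        ultimately show ?thesis using 2(1) by simp
      qed
    qed
  next
    fix u assume u: "u \<in> ?A \<union> ?B \<union> ?C"
    then consider "u \<in> ?A" | "u \<in> ?B" | "u \<in> ?C" by blast
    then have "{u, v} \<in> edges (link k G x y)"
    proof cases
      case 1
      then show ?thesis using i unfolding edges_link by auto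
    next
      case 2
      then have "{u, v} = linking_edge i" "i \<in> {1..<k}"
        using i by (auto simp: linking_edge_def split: if_splits)
      then show ?thesis unfolding edges_link by auto
    next
      case 3
      then have "{u, v} = linking_edge (i - 1)" "i - 1 \<in> {1..<k}"
        using i by (auto simp: linking_edge_def split: if_splits)
      then show ?thesis unfolding edges_link by auto
    qed
    then show "u \<in> {u \<in> vertices (link k G x y). {u, v} \<in> edges (link k G x y)}"
      using edge_in_vertices(1)[OF finite_simple_link] by auto
  qed
  moreover have "finite ?A"
    using part(1)[OF i] by (auto simp: finite_simple_graph_def)
  moreover have "x (Suc i) \<notin> vertices (G i)" if "i < k"
    using part_unique[of "Suc i" i] part(3)[of "Suc i"] that i by force
  moreover have "y (i - 1) \<notin> vertices (G i)" if "1 < i"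
    using part_unique[of "i - 1" i] part(4)[of "i - 1"] that i by force
  moreover have "y (i - 1) \<noteq> x (Suc i)" if "1 < i" "i < k"
    using part_unique[of "i - 1" "Suc i"] part(4)[of "i - 1"] part(3)[of "Suc i"] that by force
  ultimately have "degree (link k G x y) v = card ?A + card ?B + card ?C"
    unfolding degree_def by (auto simp: card_insert_if)
  then show ?thesis
    by (simp add: degree_def)
qed

end

section \<open>Links of cycles with adjacent contact vertices\<close>

locale linked_cycles = linked_graphs k G x y
  for k :: nat and G :: "nat \<Rightarrow> 'a sgraph" and x y :: "nat \<Rightarrow> 'a" +
  fixes q :: nat
  assumes q: "q \<ge> 3" and k: "k \<ge> 2"
    and cycle: "\<And>i. i \<in> {1..k} \<Longrightarrow> isomorphic (G i) (cycle_graph q)"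
    and distance: "\<And>i. i \<in> {1..k} \<Longrightarrow> graph_distance (G i) (x i) (y i) = 1"
begin

lemma contact_edge:
  assumes "i \<in> {1..k}"
  shows "{x i, y i} \<in> edges (G i)" "x i \<noteq> y i"
proof -
  show e: "{x i, y i} \<in> edges (G i)"
    using graph_distance_1_imp_edge[OF part(2-4) distance] assms by simp
  show "x i \<noteq> y i"
    using edge_in_vertices(3)[OF part(1)[OF assms] e] .
qed

lemma degree_linked_cycles:
  assumes "i \<in> {1..k}" "v \<in> vertices (G i)"
  shows "degree (link k G x y) v = (if v = y i \<and> i < k \<or> v = x i \<and> 1 < i then 3 else 2)"
  using degree_link[OF assms] cycle_copy(2)[OF q part(1) cycle, OF assms(1,1,2)]
    contact_edge(2)[OF assms(1)] by auto

text \<open>Within a part the only candidates for vertices of degree 3 are its contact vertices, so at most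
  one of its edges qualifies. The first and the last part have a single such vertex, which is why
  only the indices from 2 to \<open>k - 1\<close> give an edge besides the linking ones.\<close>

lemma edges_joining_degree_3:
  "{e \<in> edges (link k G x y). \<forall>v\<in>e. degree (link k G x y) v = 3} =
    linking_edge ` {1..<k} \<union> (\<lambda>i. {x i, y i}) ` {2..<k}" (is "?M = ?R")
proof (intro equalityI subsetI)
  fix e assume e: "e \<in> ?M"
  then consider i where "i \<in> {1..k}" "e \<in> edges (G i)" | "e \<in> linking_edge ` {1..<k}"
    unfolding edges_link by blast
  then show "e \<in> ?R"
  proof cases
    case 1
    obtain u v where uv: "e = {u, v}" "u \<noteq> v" "u \<in> vertices (G i)" "v \<in> vertices (G i)"
      using edge_endpoints[OF part(1)[OF 1(1)] 1(2)] .
    have "degree (link k G x y) w = 3" if "w \<in> {u, v}" for w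
      using e uv(1) that by blast
    then have "u = y i \<and> i < k \<or> u = x i \<and> 1 < i" "v = y i \<and> i < k \<or> v = x i \<and> 1 < i"
      using degree_linked_cycles[OF 1(1) uv(3)] degree_linked_cycles[OF 1(1) uv(4)]
      by (auto split: if_splits)
    then have "e = {x i, y i}" "i \<in> {2..<k}"
      using uv by auto
    then show ?thesis by auto
  qed auto
next
  fix e assume "e \<in> ?R"
  then consider i where "i \<in> {1..<k}" "e = linking_edge i" | i where "i \<in> {2..<k}" "e = {x i, y i}"
    by auto
  then show "e \<in> ?M"
  proof cases
    case 1
    then have "degree (link k G x y) (y i) = 3" "degree (link k G x y) (x (Suc i)) = 3"
      using degree_linked_cycles[of i "y i"] degree_linked_cycles[of "Suc i" "x (Suc i)"]
        part(3)[of "Suc i"] part(4)[of i] by auto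
    moreover have "e \<in> edges (link k G x y)"
      using 1 by (auto simp: edges_link)
    ultimately show ?thesis
      using 1(2) by (auto simp: linking_edge_def)
  next
    case 2
    then have i: "i \<in> {1..k}" by auto
    then have "degree (link k G x y) (y i) = 3" "degree (link k G x y) (x i) = 3"
      using degree_linked_cycles[OF i part(4)] degree_linked_cycles[OF i part(3)] 2 by auto
    moreover have "e \<in> edges (link k G x y)"
      using contact_edge(1)[OF i] 2 i unfolding edges_link by blast
    ultimately show ?thesis
      using 2(2) by auto
  qed
qed

lemma card_edges_joining_degree_3:
  "card {e \<in> edges (link k G x y). \<forall>v\<in>e. degree (link k G x y) v = 3} = 2 * k - 3"
proof -
  have "inj_on (\<lambda>i. {x i, y i}) {2..<k}"
  proof (rule inj_onI)
    fix i j assume ij: "i \<in> {2..<k}" "j \<in> {2..<k}" and eq: "{x i, y i} = {x j, y j}"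
    then have "{x i, y i} \<in> edges (G i) \<inter> edges (G j)"
      using contact_edge(1)[of i] contact_edge(1)[of j] by simp
    then show "i = j"
      using disjoint_inner_edges[of i j] ij by auto
  qed
  then have "card ((\<lambda>i. {x i, y i}) ` {2..<k}) = k - 2"
    by (simp add: card_image)
  moreover have "card (linking_edge ` {1..<k}) = k - 1"
    using inj_on_linking_edge by (simp add: card_image)
  moreover have "linking_edge ` {1..<k} \<inter> (\<lambda>i. {x i, y i}) ` {2..<k} = {}"
  proof -
    have "linking_edge i \<noteq> {x j, y j}" if "i \<in> {1..<k}" "j \<in> {2..<k}" for i j
      using linking_edge_not_inner[OF that(1), of j] contact_edge(1)[of j] that(2) by auto
    then show ?thesis by blast
  qed
  ultimately show ?thesis
    using k unfolding edges_joining_degree_3 by (simp add: card_Un_disjoint)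
qed

lemma ABC_linked_cycles:
  "ABC (link k G x y) = (4 * real k - 6) / 3 + (real q * real k - real k + 2) / sqrt 2"
proof -
  have "degree (link k G x y) v \<in> {2, 3}" if v: "v \<in> vertices (link k G x y)" for v
  proof -
    obtain i where "i \<in> {1..k}" "v \<in> vertices (G i)"
      using v by (auto simp: vertices_link)
    then show ?thesis
      using degree_linked_cycles[of i v] by simp
  qed
  note ABC = ABC_degrees_2_3[OF finite_simple_link this refl, unfolded card_edges_joining_degree_3]
  have "(\<Sum>i\<in>{1..k}. card (edges (G i))) = q * k"
    using cycle_copy(1)[OF q part(1) cycle] by simp
  then have "real (card (edges (link k G x y))) = real q * real k + (real k - 1)"
    using k by (simp add: card_edges_link of_nat_diff)
  moreover have "real (2 * k - 3) = 2 * real k - 3"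
    using k by (simp add: of_nat_diff)
  ultimately have "ABC (link k G x y) = 2 / 3 * (2 * real k - 3) +
      (real q * real k + (real k - 1) - (2 * real k - 3)) / sqrt 2"
    using ABC by simp
  also have "2 / 3 * (2 * real k - 3) = (4 * real k - 6) / 3"
    by simp
  also have "real q * real k + (real k - 1) - (2 * real k - 3) = real q * real k - real k + 2"
    by simp
  finally show ?thesis .
qed

end

theorem theorem3p11:
  fixes q k :: nat and H :: "'a sgraph"
  assumes "q \<ge> 3" and "k \<ge> 2" and "is_L q 1 k H"
  shows "ABC H = (4 * real k - 6) / 3 + (real q * real k - real k + 2) / sqrt 2"
proof -
  obtain G x y where "linkable k G x y" and H: "H = link k G x y"
    and "\<forall>i\<in>{1..k}. isomorphic (G i) (cycle_graph q) \<and> graph_distance (G i) (x i) (y i) = 1"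
    using assms(3) unfolding is_L_def by blast
  then interpret linked_cycles k G x y q
    using assms(1,2) by unfold_locales auto
  show ?thesis
    unfolding H by (rule ABC_linked_cycles)
qed

end
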